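(* Let $X$ be a real Hilbert space and let $C_1,\dots,C_m\subseteq X$ ($m\ge 1$) be nonempty closed convex sets with $C:=\bigcap_{i=1}^m C_i\neq\emptyset$, satisfying the bounded regularity condition stated in the context. Let $\phi:X\to\mathbb{R}$ be a convex continuous function such that $$C_{\min}:=\{x\in C\mid \phi(x)\le\phi(y)\text{ for all }y\in C\}$$ is nonempty, and let $C_*\subseteq C_{\min}$ be a nonempty subset. Let $r_0\in\,]0,1]$ and $\bar L\ge 1$ be such that $$|\phi(x)-\phi(y)|\le \bar L\|x-y\|\quad\text{for all }x\in C_*\text{ and all }y\in B(x;r_0).$$ Fix $\delta_*\in\,]0,1/m[$ and an integer $\bar q\ge m$, let $\mathcal{M}_*=\mathcal{M}_*(\delta_*,\bar q)$ be as defined in the context, and suppose $\{(\Omega_k,w_k)\}_{k=0}^\infty\subset\mathcal{M}_*$. Then any sequence $\{y^k\}_{k=0}^\infty$ generated by the superiorized version of the DSAP algorithm (described in the context), with these $(\Omega_k,w_k)$, converges in the norm topology of $X$ to some $y^*\in C$, and exactly one of the following two cases holds: (a) $y^*\in C_{\min}$; (b) $y^*\notin C_{\min}$ and there exist a natural number $k_0$ and a $c_0\in\,]0,1[$ such that for each $x\in C_*$ and each integer $k\ge k_0$, $$\|y^{k+1}-x\|^2\le\|y^k-x\|^2-c_0\sum_{n=0}^{N_k-1}\beta_{k,n},$$ so that $\{y^k\}_{k=0}^\infty$ is strictly Fejér-monotone with respect to $C_*$, i.e., for each $x\in C_*$, $\|y^{k+1}-x\|^2<\|y^k-x\|^2$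 for all $k\ge k_0$.
   Context: Notation: $B(x;r)=\{y\in X\mid\|x-y\|\le r\}$ is the closed ball; $d(x,E)=\inf\{\|x-y\|\mid y\in E\}$; $P_i$ denotes the metric projection of $X$ onto $C_i$; $\partial\phi(x)$ is the (convex) subdifferential of $\phi$ at $x$. Bounded regularity condition (standing assumption): for each $\epsilon>0$ and each $M>0$ there exists $\delta>0$ such that for each $x\in B(0;M)$ satisfying $d(x,C_i)\le\delta$ for all $i=1,\dots,m$, one has $d(x,C)\le\epsilon$. String-averaging operators: An index vector is a vector $t=(t_1,\dots,t_q)$ with $t_i\in\{1,\dots,m\}$ for all $i$; its length is $\ell(t)=q$. Put $P[t]:=P_{t_q}\cdots P_{t_1}$ (composition, $P_{t_1}$ applied first). A finite set $\Omega$ of index vectors is fit if for each $i\in\{1,\dots,m\}$ there is $t\in\Omega$ with $t_s=i$ for some $s$. $\mathcal{M}$ is the collection of all pairs $(\Omega,w)$ where $\Omega$ is a finite fit set of index vectors and $w:\Omega\to\,]0,\infty[$ satisfies $\sum_{t\in\Omega}w(t)=1$. For $(\Omega,w)\in\mathcal{M}$ let $P_{\Omega,w}(x):=\sum_{t\in\Omega}w(t)P[t](x)$, $x\in X$. Given $\delta_*\in\,]0,1/m[$ and an integer $\bar q\ge m$, $$\mathcal{M}_*(\delta_*,\bar q):=\{(\Omega,w)\in\mathcal{M}\mid \ell(t)\le\bar q\text{ and }w(t)\ge\delta_*\text{ for all }t\in\Omega\}.$$ Superiorized version of the DSAP (dynamic string-averaging projection) algorithm: Fix a natural number $N\geq 1$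 and an arbitrary $y^0\in X$. For each $k\ge 0$, given $y^k$, pick $N_k\in\{1,\dots,N\}$, set $y^{k,0}=y^k$, and for $n=0,1,\dots,N_k-1$ set $$y^{k,n+1}=y^{k,n}+\beta_{k,n}v^{k,n},$$ where $v^{k,n}=-s^{k,n}/\|s^{k,n}\|$ for some (arbitrarily chosen) $s^{k,n}\in\partial\phi(y^{k,n})$ if $0\notin\partial\phi(y^{k,n})$, and $v^{k,n}=0$ if $0\in\partial\phi(y^{k,n})$. Here the numbers $0<\beta_{k,n}\le 1$ are chosen so that $\sum_{k=0}^\infty\sum_{n=0}^{N_k-1}\beta_{k,n}<\infty$. Finally set $y^{k+1}=P_{\Omega_k,w_k}(y^{k,N_k})$ with $(\Omega_k,w_k)\in\mathcal{M}_*$. *)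

theory Defs
  imports "HOL-Analysis.Analysis"
begin

(* The library's closest_point is restricted to Heine-Borel (i.e. finite-dimensional) spaces. *)
definition metric_proj :: "'a::real_inner set \<Rightarrow> 'a \<Rightarrow> 'a" where
  "metric_proj S x = (THE p. p \<in> S \<and> (\<forall>y\<in>S. dist x p \<le> dist x y))"

definition subdifferential :: "('a::real_inner \<Rightarrow> real) \<Rightarrow> 'a \<Rightarrow> 'a set" where
  "subdifferential \<phi> x = {s. \<forall>y. \<phi> x + s \<bullet> (y - x) \<le> \<phi> y}"

definition minimizers :: "('a \<Rightarrow> real) \<Rightarrow> 'a set \<Rightarrow> 'a set" where
  "minimizers \<phi> S = {x \<in> S. \<forall>y\<in>S. \<phi> x \<le> \<phi> y}"

(* C is used at the indices 1, ..., m only. *)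
definition boundedly_regular :: "nat \<Rightarrow> (nat \<Rightarrow> 'a::real_inner set) \<Rightarrow> bool" where
  "boundedly_regular m C \<longleftrightarrow>
     (\<forall>\<epsilon>>0. \<forall>M>0. \<exists>\<delta>>0. \<forall>x\<in>cball 0 M.
        (\<forall>i\<in>{1..m}. infdist x (C i) \<le> \<delta>) \<longrightarrow> infdist x (\<Inter>i\<in>{1..m}. C i) \<le> \<epsilon>)"

(* An index vector (t_1, ..., t_q), q \<ge> 1, is the list [t_1, ..., t_q]. *)
definition index_vectors :: "nat \<Rightarrow> nat list set" where
  "index_vectors m = {t. t \<noteq> [] \<and> set t \<subseteq> {1..m}}"

definition fit :: "nat \<Rightarrow> nat list set \<Rightarrow> bool" where
  "fit m \<Omega> \<longleftrightarrow> (\<forall>i\<in>{1..m}. \<exists>t\<in>\<Omega>. i \<in> set t)"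

(* fold applies the projection of the head of the list first. *)
definition string_proj :: "(nat \<Rightarrow> 'a::real_inner set) \<Rightarrow> nat list \<Rightarrow> 'a \<Rightarrow> 'a" where
  "string_proj C t = fold (\<lambda>i. metric_proj (C i)) t"

(* A weight function is total on lists, but only its values on \<Omega> are ever used. *)
definition amalgamators :: "nat \<Rightarrow> (nat list set \<times> (nat list \<Rightarrow> real)) set" where
  "amalgamators m = {(\<Omega>, w). finite \<Omega> \<and> \<Omega> \<subseteq> index_vectors m \<and> fit m \<Omega> \<and>
     (\<forall>t\<in>\<Omega>. 0 < w t) \<and> (\<Sum>t\<in>\<Omega>. w t) = 1}"

definition amalgamators_star ::
    "nat \<Rightarrow> real \<Rightarrow> nat \<Rightarrow> (nat list set \<times> (nat list \<Rightarrow> real)) set" where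
  "amalgamators_star m \<delta> q = {(\<Omega>, w) \<in> amalgamators m. \<forall>t\<in>\<Omega>. length t \<le> q \<and> \<delta> \<le> w t}"

definition string_avg ::
    "(nat \<Rightarrow> 'a::real_inner set) \<Rightarrow> nat list set \<Rightarrow> (nat list \<Rightarrow> real) \<Rightarrow> 'a \<Rightarrow> 'a" where
  "string_avg C \<Omega> w x = (\<Sum>t\<in>\<Omega>. w t *\<^sub>R string_proj C t x)"

definition descent_direction :: "('a::real_inner \<Rightarrow> real) \<Rightarrow> 'a \<Rightarrow> 'a \<Rightarrow> bool" where
  "descent_direction \<phi> x v \<longleftrightarrow>
     (if 0 \<in> subdifferential \<phi> x then v = 0
      else (\<exists>s \<in> subdifferential \<phi> x. v = - (s /\<^sub>R norm s)))"

(* y is generated with step numbers K k (written N_k in the literature) and step sizes \<beta> k n;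
   z k n are the inner iterates y^{k,n}. Only \<beta> k n and v k n with n < K k matter. *)
definition superiorized_DSAP ::
    "(nat \<Rightarrow> 'a::real_inner set) \<Rightarrow> ('a \<Rightarrow> real) \<Rightarrow> nat \<Rightarrow> (nat \<Rightarrow> nat list set) \<Rightarrow>
     (nat \<Rightarrow> nat list \<Rightarrow> real) \<Rightarrow> (nat \<Rightarrow> nat) \<Rightarrow> (nat \<Rightarrow> nat \<Rightarrow> real) \<Rightarrow> (nat \<Rightarrow> 'a) \<Rightarrow> bool" where
  "superiorized_DSAP C \<phi> N \<Omega> w K \<beta> y \<longleftrightarrow>
     (\<forall>k. K k \<in> {1..N}) \<and>
     (\<forall>k. \<forall>n<K k. 0 < \<beta> k n \<and> \<beta> k n \<le> 1) \<and>
     summable (\<lambda>k. \<Sum>n<K k. \<beta> k n) \<and>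
     (\<exists>z v. \<forall>k. z k 0 = y k \<and>
        (\<forall>n<K k. descent_direction \<phi> (z k n) (v k n) \<and>
                 z k (Suc n) = z k n + \<beta> k n *\<^sub>R v k n) \<and>
        y (Suc k) = string_avg C (\<Omega> k) (w k) (z k (K k)))"

end

(* The iteration is a summable perturbation u k = y k + e k, norm (e k) <= b k, of the averaged
   projections, so the distances to each point of the intersection S of the C i are quasi-decreasing
   and converge. One averaging step decreases the squared distance to a point of S by at least a
   constant times (infdist (u k) (C i))^2; hence the iterates approach every C i, by bounded
   regularity they approach S, and quasi-Fejer monotonicity makes them a Cauchy sequence.
   If the limit is not a minimizer, the inner iterates eventually stay at values above
   min phi + Lbar * r for some small r > 0, so phi is smaller on the whole ball of radius r around
   each point x of Cstar. Each normalized subgradient step of length beta <= r then lowers the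
   squared distance to x by at least r * beta, and the averaged projections do not increase it. *)

theory Submission
  imports Defs
begin

section \<open>Metric projections onto closed convex sets\<close>

text \<open>Completeness replaces compactness: by the parallelogram law, two points of
  \<open>S\<close> that nearly attain the infimal distance to \<open>a\<close> are close to each
  other. The closed nested sets \<open>F n\<close> of near-minimizers therefore have arbitrarily
  small diameter and share a point.\<close>

lemma closed_convex_nearest_point_exists:
  fixes S :: "'a::{real_inner, complete_space} set"
  assumes "S \<noteq> {}" "closed S" "convex S"
  obtains p where "p \<in> S" "\<forall>q\<in>S. dist a p \<le> dist a q"
proof -
  define d where "d = infdist a S"
  define \<epsilon> where "\<epsilon> n = inverse (real (Suc n))" for n
  define F where "F n = S \<inter> cball a (d + \<epsilon> n)" for n
  have \<epsilon>0: "\<epsilon> \<longlonglongrightarrow> 0"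
    unfolding \<epsilon>_def by (rule LIMSEQ_inverse_real_of_nat)
  have d: "0 \<le> d" "\<And>q. q \<in> S \<Longrightarrow> d \<le> dist a q"
    unfolding d_def by (auto intro: infdist_nonneg infdist_le)
  have "\<exists>p. \<forall>n. p \<in> F n"
  proof (rule decreasing_closed_nest[of F])
    show "closed (F n)" for n
      using assms(2) by (auto simp: F_def)
    show "F n \<noteq> {}" for n
    proof -
      have "(INF q\<in>S. dist a q) < d + \<epsilon> n"
        using assms(1) by (simp add: d_def infdist_notempty \<epsilon>_def)
      then obtain q where "q \<in> S" "dist a q < d + \<epsilon> n"
        using assms(1) by (meson bdd_below_image_dist cINF_less_iff)
      then show ?thesis
        by (auto simp: F_def)
    qed
    show "F n \<subseteq> F k" if "k \<le> n" for k n
    proof -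
      have "\<epsilon> n \<le> \<epsilon> k"
        using that by (auto simp: \<epsilon>_def intro: le_imp_inverse_le)
      then show ?thesis
        by (auto simp: F_def)
    qed
    show "\<exists>n. \<forall>p\<in>F n. \<forall>q\<in>F n. dist p q < e" if "0 < e" for e
    proof -
      \<comment> \<open>This expression is \<open>4 * (d + \<epsilon> n)^2 - 4 * d^2\<close>. It
        bounds the squared distance of two points of \<open>F n\<close>, since their midpoint lies
        in \<open>S\<close> by convexity and so has distance at least \<open>d\<close> from
        \<open>a\<close>.\<close>
      have "(\<lambda>n. 8 * d * \<epsilon> n + 4 * (\<epsilon> n)\<^sup>2) \<longlonglongrightarrow> 8 * d * 0 + 4 * 0\<^sup>2"
        by (intro tendsto_intros \<epsilon>0)
      then have "\<forall>\<^sub>F n in sequentially. 8 * d * \<epsilon> n + 4 * (\<epsilon> n)\<^sup>2 < e\<^sup>2"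
        using that by (intro order_tendstoD) auto
      then obtain n where n: "8 * d * \<epsilon> n + 4 * (\<epsilon> n)\<^sup>2 < e\<^sup>2"
        by (auto simp: eventually_sequentially)
      have "dist p q < e" if "p \<in> F n" "q \<in> F n" for p q
      proof -
        have "(1/2) *\<^sub>R p + (1/2) *\<^sub>R q \<in> S"
          using that assms(3) by (intro convexD) (auto simp: F_def)
        then have "d \<le> norm (a - ((1/2) *\<^sub>R p + (1/2) *\<^sub>R q))"
          using d(2) by (simp add: dist_norm)
        then have "d\<^sup>2 \<le> (norm (a - ((1/2) *\<^sub>R p + (1/2) *\<^sub>R q)))\<^sup>2"
          using d(1) by (intro power_mono)
        moreover have "(norm (a - p))\<^sup>2 \<le> (d + \<epsilon> n)\<^sup>2" "(norm (a - q))\<^sup>2 \<le> (d + \<epsilon> n)\<^sup>2"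
          using that by (auto simp: F_def dist_norm intro: power_mono)
        moreover have "(norm (p - q))\<^sup>2 = 2 * (norm (a - p))\<^sup>2 + 2 * (norm (a - q))\<^sup>2
            - 4 * (norm (a - ((1/2) *\<^sub>R p + (1/2) *\<^sub>R q)))\<^sup>2"
          by (simp add: power2_norm_eq_inner inner_diff inner_add inner_commute algebra_simps)
        ultimately have "(norm (p - q))\<^sup>2 < e\<^sup>2"
          using n by (simp add: power2_sum algebra_simps)
        then show ?thesis
          using \<open>0 < e\<close> by (simp add: dist_norm power2_less_imp_less)
      qed
      then show ?thesis
        by blast
    qed
  qed blast
  then obtain p where p: "\<And>n. p \<in> F n"
    by blast
  have "dist a p \<le> d"
  proof (rule LIMSEQ_le_const)
    show "(\<lambda>n. d + \<epsilon> n) \<longlonglongrightarrow> d"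
      using tendsto_add[OF tendsto_const \<epsilon>0] by simp
    show "\<exists>N. \<forall>n\<ge>N. dist a p \<le> d + \<epsilon> n"
      using p by (auto simp: F_def)
  qed
  with p d(2) show thesis
    by (intro that[of p]) (force simp: F_def)+
qed

text \<open>With existence at hand and uniqueness from convexity, the description in
  \<open>metric_proj\<close> denotes the nearest point.\<close>

lemma
  fixes S :: "'a::{real_inner, complete_space} set"
  assumes "S \<noteq> {}" "closed S" "convex S"
  shows metric_proj_in: "metric_proj S a \<in> S"
    and metric_proj_le: "q \<in> S \<Longrightarrow> dist a (metric_proj S a) \<le> dist a q"
proof -
  obtain p where p: "p \<in> S" "\<forall>q\<in>S. dist a p \<le> dist a q"
    using closed_convex_nearest_point_exists[OF assms] .
  then have "metric_proj S a = p"
    unfolding metric_proj_def using assms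
    by (intro the_equality) (auto intro: any_closest_point_unique[of S])
  with p show "metric_proj S a \<in> S" "q \<in> S \<Longrightarrow> dist a (metric_proj S a) \<le> dist a q"
    by auto
qed

text \<open>The vectors \<open>a - ?p\<close> and \<open>x - ?p\<close> enclose no acute angle, so
  the cross term in the expansion of the squared distance from \<open>a\<close> to \<open>x\<close>
  around \<open>?p\<close> has the right sign. The length of the projection step is kept as a gain
  for later use.\<close>

lemma metric_proj_fejer:
  fixes S :: "'a::{real_inner, complete_space} set"
  assumes "closed S" "convex S" "x \<in> S"
  shows "(norm (metric_proj S a - x))\<^sup>2 + (dist a (metric_proj S a))\<^sup>2 \<le> (norm (a - x))\<^sup>2"
proof -
  let ?p = "metric_proj S a"
  have ne: "S \<noteq> {}"
    using assms by auto
  have "(a - ?p) \<bullet> (x - ?p) \<le> 0"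
    using assms metric_proj_in[OF ne] metric_proj_le[OF ne]
    by (intro any_closest_point_dot[of S]) auto
  then show ?thesis
    by (simp add: power2_norm_eq_inner dist_norm inner_diff inner_commute algebra_simps)
qed

section \<open>Fejer estimates for strings of projections and their averages\<close>

lemma string_proj_fejer:
  fixes C :: "nat \<Rightarrow> 'a::{real_inner, complete_space} set"
  assumes "\<And>i. i \<in> set t \<Longrightarrow> closed (C i) \<and> convex (C i) \<and> x \<in> C i"
  shows "(norm (string_proj C t u - x))\<^sup>2 \<le> (norm (u - x))\<^sup>2"
  using assms
proof (induction t arbitrary: u)
  case Nil
  then show ?case
    by (simp add: string_proj_def)
next
  case (Cons j t)
  let ?p = "metric_proj (C j) u"
  have "(norm (string_proj C (j # t) u - x))\<^sup>2 \<le> (norm (?p - x))\<^sup>2"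
    using Cons.IH[of ?p] Cons.prems by (simp add: string_proj_def)
  also have "\<dots> \<le> (norm (u - x))\<^sup>2"
    using Cons.prems[of j] by (intro order_trans[OF _ metric_proj_fejer[of "C j"]]) auto
  finally show ?case .
qed

text \<open>The factor \<^term>\<open>1 / length t\<close> comes from Cauchy--Schwarz: \<^term>\<open>u\<close> reaches
  \<^term>\<open>C i\<close> in at most \<^term>\<open>length t\<close> projection steps, and the squared lengths of the steps are
  summed on the left-hand side.\<close>

lemma string_proj_fejer_infdist:
  fixes C :: "nat \<Rightarrow> 'a::{real_inner, complete_space} set"
  assumes "\<And>i. i \<in> set t \<Longrightarrow> closed (C i) \<and> convex (C i) \<and> x \<in> C i" and "i \<in> set t"
  shows "(norm (string_proj C t u - x))\<^sup>2 + (infdist u (C i))\<^sup>2 / length t \<le> (norm (u - x))\<^sup>2"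
  using assms
proof (induction t arbitrary: u)
  case Nil
  then show ?case
    by simp
next
  case (Cons j t)
  let ?p = "metric_proj (C j) u"
  let ?l = "real (length t)"
  have step: "string_proj C (j # t) u = string_proj C t ?p"
    by (simp add: string_proj_def)
  have j: "closed (C j)" "convex (C j)" "x \<in> C j"
    using Cons.prems by auto
  have fej: "(norm (?p - x))\<^sup>2 + (dist u ?p)\<^sup>2 \<le> (norm (u - x))\<^sup>2"
    by (rule metric_proj_fejer[OF j])
  show ?case
  proof (cases "i \<in> set t")
    case True
    then have l: "0 < ?l"
      by (cases t) auto
    have IH: "(norm (string_proj C t ?p - x))\<^sup>2 + (infdist ?p (C i))\<^sup>2 / ?l \<le> (norm (?p - x))\<^sup>2"
      using Cons.IH[of ?p] Cons.prems True by simp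
    define d where "d = infdist ?p (C i)"
    define s where "s = dist u ?p"
    have "infdist u (C i) \<le> d + s"
      unfolding d_def s_def by (rule infdist_triangle)
    then have "(infdist u (C i))\<^sup>2 \<le> (d + s)\<^sup>2"
      by (intro power_mono infdist_nonneg)
    \<comment> \<open>The weights \<open>?l\<close> and \<open>1\<close> turn the factor
      \<open>1 / ?l\<close> of the induction hypothesis into \<open>1 / (1 + ?l)\<close>; the gap
      between the two sides is a square divided by \<open>?l\<close>.\<close>
    also have "(d + s)\<^sup>2 \<le> (1 + ?l) * (d\<^sup>2 / ?l + s\<^sup>2)"
    proof -
      have "(1 + ?l) * (d\<^sup>2 / ?l + s\<^sup>2) - (d + s)\<^sup>2 = (d - ?l * s)\<^sup>2 / ?l"
        using l by (simp add: field_simps power2_eq_square)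
      also have "\<dots> \<ge> 0"
        using l by simp
      finally show ?thesis
        by simp
    qed
    finally have "(infdist u (C i))\<^sup>2 / length (j # t) \<le> d\<^sup>2 / ?l + s\<^sup>2"
      using l by (simp add: divide_le_eq mult.commute)
    with IH fej show ?thesis
      unfolding step d_def s_def by linarith
  next
    \<comment> \<open>The first projection already lands in \<open>C i\<close>, so its step alone is
      at least as long as the distance from \<open>u\<close> to \<open>C i\<close>.\<close>
    case False
    then have "i = j"
      using Cons.prems by auto
    then have "infdist u (C i) \<le> dist u ?p"
      using metric_proj_in[of "C j" u] j by (auto intro: infdist_le)
    then have "(infdist u (C i))\<^sup>2 \<le> (dist u ?p)\<^sup>2"
      by (intro power_mono infdist_nonneg)
    moreover have "(infdist u (C i))\<^sup>2 / length (j # t) \<le> (infdist u (C i))\<^sup>2"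
      by (simp add: divide_le_eq mult_right_mono algebra_simps)
    moreover have "(norm (string_proj C t ?p - x))\<^sup>2 \<le> (norm (?p - x))\<^sup>2"
      using Cons.prems by (intro string_proj_fejer) auto
    ultimately show ?thesis
      using fej unfolding step by linarith
  qed
qed

text \<open>Jensen's inequality: the triangle inequality reduces it to convexity of the real
  square.\<close>

lemma norm_convex_combination_sq_le:
  fixes f :: "'b \<Rightarrow> 'a::real_normed_vector"
  assumes "finite T" "\<And>t. t \<in> T \<Longrightarrow> 0 \<le> w t" "(\<Sum>t\<in>T. w t) = 1"
  shows "(norm ((\<Sum>t\<in>T. w t *\<^sub>R f t) - x))\<^sup>2 \<le> (\<Sum>t\<in>T. w t * (norm (f t - x))\<^sup>2)"
proof -
  have "(\<Sum>t\<in>T. w t *\<^sub>R f t) - x = (\<Sum>t\<in>T. w t *\<^sub>R (f t - x))"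
    using assms(3) by (simp add: scaleR_diff_right sum_subtractf flip: scaleR_left.sum)
  also have "norm \<dots> \<le> (\<Sum>t\<in>T. norm (w t *\<^sub>R (f t - x)))"
    by (rule norm_sum)
  also have "\<dots> = (\<Sum>t\<in>T. w t * norm (f t - x))"
    using assms(2) by (intro sum.cong) auto
  finally have "(norm ((\<Sum>t\<in>T. w t *\<^sub>R f t) - x))\<^sup>2 \<le> (\<Sum>t\<in>T. w t * norm (f t - x))\<^sup>2"
    by (intro power_mono) auto
  also have "\<dots> \<le> (\<Sum>t\<in>T. w t * (norm (f t - x))\<^sup>2)"
    using convex_on_sum[OF assms(1) _ convex_power2 assms(3), of "\<lambda>t. norm (f t - x)"] assms
    by fastforce
  finally show ?thesis .
qed

text \<open>By fitness some string \<open>r\<close> visits \<open>C i\<close> and contributes the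
  gain of its own estimate, while the other strings do not increase the distance to
  \<open>x\<close>. Since \<open>r\<close> has weight at least \<delta> and length at most
  \<open>q\<close>, the constant is uniform over all admissible pairs.\<close>

lemma string_avg_fejer_infdist:
  fixes C :: "nat \<Rightarrow> 'a::{real_inner, complete_space} set"
  assumes C: "\<And>i. i \<in> {1..m} \<Longrightarrow> closed (C i) \<and> convex (C i)"
    and x: "x \<in> (\<Inter>i\<in>{1..m}. C i)"
    and \<Omega>: "(\<Omega>, w) \<in> amalgamators_star m \<delta> q"
    and "0 \<le> \<delta>" "i \<in> {1..m}"
  shows "(norm (string_avg C \<Omega> w u - x))\<^sup>2 + \<delta> / q * (infdist u (C i))\<^sup>2 \<le> (norm (u - x))\<^sup>2"
proof -
  have fin: "finite \<Omega>" and w: "\<And>t. t \<in> \<Omega> \<Longrightarrow> 0 \<le> w t" "(\<Sum>t\<in>\<Omega>. w t) = 1"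
    and sub: "\<And>t. t \<in> \<Omega> \<Longrightarrow> set t \<subseteq> {1..m}"
    and len: "\<And>t. t \<in> \<Omega> \<Longrightarrow> length t \<le> q \<and> \<delta> \<le> w t"
    and fit: "fit m \<Omega>"
    using \<Omega> by (auto simp: amalgamators_star_def amalgamators_def index_vectors_def
        intro: less_imp_le)
  obtain r where r: "r \<in> \<Omega>" "i \<in> set r"
    using fit \<open>i \<in> {1..m}\<close> unfolding fit_def by blast
  have CR: "closed (C j) \<and> convex (C j) \<and> x \<in> C j" if "t \<in> \<Omega>" "j \<in> set t" for t j
    using C x sub[OF that(1)] that(2) by blast
  let ?g = "\<lambda>t. (norm (string_proj C t u - x))\<^sup>2"
  let ?D = "(infdist u (C i))\<^sup>2"
  have "(norm (string_avg C \<Omega> w u - x))\<^sup>2 \<le> (\<Sum>t\<in>\<Omega>. w t * ?g t)"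
    unfolding string_avg_def by (rule norm_convex_combination_sq_le[OF fin w])
  also have "\<dots> = w r * ?g r + (\<Sum>t\<in>\<Omega> - {r}. w t * ?g t)"
    using fin r by (simp add: sum.remove)
  also have "\<dots> \<le> w r * ((norm (u - x))\<^sup>2 - ?D / length r)
      + (\<Sum>t\<in>\<Omega> - {r}. w t * (norm (u - x))\<^sup>2)"
  proof (intro add_mono mult_left_mono sum_mono)
    show "?g r \<le> (norm (u - x))\<^sup>2 - ?D / length r"
      using string_proj_fejer_infdist[where C = C and x = x and t = r and i = i and u = u] CR r
      by fastforce
    show "?g t \<le> (norm (u - x))\<^sup>2" if "t \<in> \<Omega> - {r}" for t
      using that CR by (intro string_proj_fejer) auto
  qed (use w r in auto)
  also have "\<dots> = (norm (u - x))\<^sup>2 * (\<Sum>t\<in>\<Omega>. w t) - w r * (?D / length r)"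
    using fin r by (simp add: sum.remove sum_distrib_right algebra_simps)
  finally have "(norm (string_avg C \<Omega> w u - x))\<^sup>2 + w r * (?D / length r) \<le> (norm (u - x))\<^sup>2"
    using w by simp
  moreover have "0 < length r" "0 < q"
    using length_pos_if_in_set[OF r(2)] len[OF r(1)] by linarith+
  then have "\<delta> * (?D / q) \<le> w r * (?D / length r)"
    using len[OF r(1)] \<open>0 \<le> \<delta>\<close> by (intro mult_mono divide_left_mono mult_pos_pos) auto
  ultimately show ?thesis
    by simp
qed

lemma string_avg_fejer:
  fixes C :: "nat \<Rightarrow> 'a::{real_inner, complete_space} set"
  assumes "m \<ge> 1"
    and "\<And>i. i \<in> {1..m} \<Longrightarrow> closed (C i) \<and> convex (C i)"
    and "x \<in> (\<Inter>i\<in>{1..m}. C i)"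
    and "(\<Omega>, w) \<in> amalgamators_star m \<delta> q"
    and "0 \<le> \<delta>"
  shows "norm (string_avg C \<Omega> w u - x) \<le> norm (u - x)"
proof -
  \<comment> \<open>The index \<open>1\<close> is available because \<open>m \<ge> 1\<close>; its
    nonnegative gain is then dropped.\<close>
  have "(norm (string_avg C \<Omega> w u - x))\<^sup>2 + \<delta> / q * (infdist u (C 1))\<^sup>2 \<le> (norm (u - x))\<^sup>2"
    using assms by (intro string_avg_fejer_infdist[where m = m]) auto
  moreover have "0 \<le> \<delta> / q * (infdist u (C 1))\<^sup>2"
    using assms(5) by simp
  ultimately have "(norm (string_avg C \<Omega> w u - x))\<^sup>2 \<le> (norm (u - x))\<^sup>2"
    by linarith
  then show ?thesis
    by (rule power2_le_imp_le) simp
qed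

section \<open>Convergence of quasi-Fejer sequences and of perturbed averaged projections\<close>

text \<open>Subtracting the partial sums of \<open>b\<close> from \<open>a\<close> leaves a
  decreasing sequence that is bounded below.\<close>

lemma quasi_decreasing_convergent:
  fixes a b :: "nat \<Rightarrow> real"
  assumes "\<And>k. a (Suc k) \<le> a k + b k" "\<And>k. 0 \<le> a k" "summable b"
  shows "convergent a"
proof -
  define c where "c k = a k - sum b {..<k}" for k
  have S: "(\<lambda>k. sum b {..<k}) \<longlonglongrightarrow> suminf b"
    by (rule summable_LIMSEQ[OF assms(3)])
  then have "Bseq (\<lambda>k. sum b {..<k})"
    by (intro convergent_imp_Bseq convergentI)
  then obtain B where B: "\<forall>k. norm (sum b {..<k}) \<le> B"
    by (rule BseqE)
  have "- B \<le> c k" for k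
    using assms(2)[of k] B[rule_format, of k] by (simp add: c_def)
  moreover have "decseq c"
    using assms(1) by (intro decseq_SucI) (simp add: c_def algebra_simps)
  ultimately obtain l where "c \<longlonglongrightarrow> l"
    using decseq_convergent by blast
  then have "(\<lambda>k. c k + sum b {..<k}) \<longlonglongrightarrow> l + suminf b"
    by (intro tendsto_add S)
  then show ?thesis
    by (auto simp: c_def convergent_def)
qed

text \<open>Once \<open>y k\<close> is near a point of \<open>S\<close> and the remaining sum of
  \<open>b\<close> is small, all later iterates stay near that same point. This makes
  \<open>y\<close> Cauchy, and closedness puts its limit into \<open>S\<close>.\<close>

lemma quasi_fejer_convergent:
  fixes y :: "nat \<Rightarrow> 'a::complete_space"
  assumes quasi: "\<And>x k. x \<in> S \<Longrightarrow> dist (y (Suc k)) x \<le> dist (y k) x + b k"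
    and b: "summable b" "\<And>k. 0 \<le> b k"
    and S: "S \<noteq> {}" "closed S" and dist0: "(\<lambda>k. infdist (y k) S) \<longlonglongrightarrow> 0"
  obtains l where "l \<in> S" "y \<longlonglongrightarrow> l"
proof -
  have tail: "dist (y (k + n)) x \<le> dist (y k) x + (\<Sum>i. b (i + k))" if "x \<in> S" for x k n
  proof -
    have "dist (y (k + n)) x \<le> dist (y k) x + (\<Sum>i<n. b (i + k))"
    proof (induction n)
      case (Suc n)
      then show ?case
        using quasi[OF that, of "k + n"] by (simp add: add.commute)
    qed simp
    also have "(\<Sum>i<n. b (i + k)) \<le> (\<Sum>i. b (i + k))"
      using b by (intro sum_le_suminf) (auto simp: summable_iff_shift)
    finally show ?thesis
      by simp
  qed
  have "Cauchy y"
    unfolding Cauchy_altdef2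
  proof (intro allI impI)
    fix e :: real
    assume "0 < e"
    \<comment> \<open>Later iterates will lie within \<open>e / 4 + e / 4\<close> of a point
      \<open>x\<close> of \<open>S\<close>, and \<open>y k\<close> within \<open>e / 4\<close> of
      it, which leaves room below \<open>e\<close>.\<close>
    obtain N1 where N1: "\<And>n. n \<ge> N1 \<Longrightarrow> norm (\<Sum>i. b (i + n)) < e / 4"
      using suminf_exist_split[OF _ b(1), of "e / 4"] \<open>0 < e\<close> by auto
    have "\<forall>\<^sub>F k in sequentially. infdist (y k) S < e / 4"
      using dist0 \<open>0 < e\<close> by (intro order_tendstoD) auto
    then obtain N2 where N2: "\<And>n. n \<ge> N2 \<Longrightarrow> infdist (y n) S < e / 4"
      by (auto simp: eventually_sequentially)
    define k where "k = max N1 N2"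
    have "(INF x\<in>S. dist (y k) x) < e / 4"
      using N2[of k] S(1) by (simp add: k_def infdist_notempty)
    then obtain x where x: "x \<in> S" "dist (y k) x < e / 4"
      using S(1) by (meson bdd_below_image_dist cINF_less_iff)
    have "dist (y n) (y k) < e" if "n \<ge> k" for n
    proof -
      have "dist (y n) x < e / 2"
        using tail[OF x(1), of k "n - k"] N1[of k] x(2) that by (simp add: k_def)
      then show ?thesis
        using x(2) dist_triangle2[of "y n" "y k" x] \<open>0 < e\<close> by linarith
    qed
    then show "\<exists>N. \<forall>n\<ge>N. dist (y n) (y N) < e"
      by blast
  qed
  then obtain l where l: "y \<longlonglongrightarrow> l"
    by (auto simp: Cauchy_convergent_iff convergent_def)
  then have "(\<lambda>k. infdist (y k) S) \<longlonglongrightarrow> infdist l S"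
    by (rule tendsto_infdist)
  then have "infdist l S = 0"
    using dist0 LIMSEQ_unique by blast
  then have "l \<in> S"
    using S by (simp add: in_closed_iff_infdist_zero)
  with l show thesis
    by (rule that[rotated])
qed

text \<open>Since \<^term>\<open>norm (y k - x)\<close> converges and \<^term>\<open>norm (u k - x)\<close> is squeezed between its shift
  and a summable perturbation of it, the decrease of the squared distance in one averaging step,
  hence \<^term>\<open>infdist (u k) (C i)\<close>, tends to zero.\<close>

lemma perturbed_string_avg_convergent:
  fixes C :: "nat \<Rightarrow> 'a::{real_inner, complete_space} set"
  assumes m: "m \<ge> 1"
    and C: "\<And>i. i \<in> {1..m} \<Longrightarrow> closed (C i) \<and> convex (C i)"
    and ne: "(\<Inter>i\<in>{1..m}. C i) \<noteq> {}"
    and reg: "boundedly_regular m C"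
    and \<delta>: "0 < \<delta>" and q: "0 < q"
    and \<Omega>: "\<And>k. (\<Omega> k, w k) \<in> amalgamators_star m \<delta> q"
    and b: "summable b" "\<And>k. norm (u k - y k) \<le> b k"
    and y: "\<And>k. y (Suc k) = string_avg C (\<Omega> k) (w k) (u k)"
  obtains l where "l \<in> (\<Inter>i\<in>{1..m}. C i)" "y \<longlonglongrightarrow> l"
proof -
  let ?S = "\<Inter>i\<in>{1..m}. C i"
  have b0: "0 \<le> b k" for k
    using b(2)[of k] norm_ge_zero order_trans by blast
  have bL: "b \<longlonglongrightarrow> 0"
    using b(1) by (rule summable_LIMSEQ_zero)
  have avg: "norm (y (Suc k) - x) \<le> norm (u k - x)" if "x \<in> ?S" for x k
    unfolding y using m C that \<Omega> \<delta> by (intro string_avg_fejer[where m = m]) auto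
  have pert: "norm (u k - x) \<le> norm (y k - x) + b k" for x k
    using b(2)[of k] norm_triangle_ineq[of "u k - y k" "y k - x"] by simp
  have quasi: "norm (y (Suc k) - x) \<le> norm (y k - x) + b k" if "x \<in> ?S" for x k
    using avg[OF that] pert order_trans by blast
  obtain x where x: "x \<in> ?S"
    using ne by blast
  have "convergent (\<lambda>k. norm (y k - x))"
    by (rule quasi_decreasing_convergent[where b = b]) (auto intro: quasi[OF x] b(1))
  then obtain L where L: "(\<lambda>k. norm (y k - x)) \<longlonglongrightarrow> L"
    by (auto simp: convergent_def)
  have L': "(\<lambda>k. norm (y (Suc k) - x)) \<longlonglongrightarrow> L"
    using L by (rule LIMSEQ_Suc)
  have uL: "(\<lambda>k. norm (u k - x)) \<longlonglongrightarrow> L"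
  proof (rule tendsto_sandwich[where f = "\<lambda>k. norm (y (Suc k) - x)"])
    show "(\<lambda>k. norm (y k - x) + b k) \<longlonglongrightarrow> L"
      using tendsto_add[OF L bL] by simp
  qed (use L' avg[OF x] pert in auto)
  have infC: "(\<lambda>k. infdist (u k) (C i)) \<longlonglongrightarrow> 0" if i: "i \<in> {1..m}" for i
  proof -
    let ?f = "\<lambda>k. ((norm (u k - x))\<^sup>2 - (norm (y (Suc k) - x))\<^sup>2) * (q / \<delta>)"
    have "?f \<longlonglongrightarrow> (L\<^sup>2 - L\<^sup>2) * (q / \<delta>)"
      by (intro tendsto_intros uL L')
    then have f: "?f \<longlonglongrightarrow> 0"
      by simp
    have "(infdist (u k) (C i))\<^sup>2 \<le> ?f k" for k
    proof -
      have "(norm (y (Suc k) - x))\<^sup>2 + \<delta> / q * (infdist (u k) (C i))\<^sup>2 \<le> (norm (u k - x))\<^sup>2"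
        unfolding y using C x \<Omega> \<delta> i by (intro string_avg_fejer_infdist[where m = m]) auto
      then show ?thesis
        using \<delta> q by (simp add: field_simps)
    qed
    then have "(\<lambda>k. (infdist (u k) (C i))\<^sup>2) \<longlonglongrightarrow> 0"
      by (intro tendsto_sandwich[OF _ _ tendsto_const f]) auto
    from tendsto_real_sqrt[OF this] show ?thesis
      by (simp add: infdist_nonneg)
  qed
  \<comment> \<open>Bounded regularity is uniform only on balls around the origin, so one ball
    containing all \<open>u k\<close> is needed.\<close>
  obtain M where M: "0 < M" "\<And>k. norm (u k) \<le> M"
  proof -
    have "Bseq (\<lambda>k. norm (u k - x))"
      using uL by (intro convergent_imp_Bseq convergentI)
    then obtain B where B: "0 < B" "\<forall>k. norm (norm (u k - x)) \<le> B"
      by (rule BseqE)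
    have "norm (u k) \<le> B + norm x" for k
      using B(2)[rule_format, of k] norm_triangle_sub[of "u k" x] by simp
    with B(1) show thesis
      by (intro that[of "B + norm x"]) (auto intro: add_pos_nonneg)
  qed
  have uS: "(\<lambda>k. infdist (u k) ?S) \<longlonglongrightarrow> 0"
  proof (rule tendstoI)
    fix e :: real
    assume e: "0 < e"
    \<comment> \<open>Regularity yields a non-strict bound and the limit asks for a strict one,
      hence the half.\<close>
    then have "0 < e / 2"
      by simp
    then obtain \<eta> where \<eta>: "0 < \<eta>" "\<forall>z\<in>cball 0 M.
        (\<forall>i\<in>{1..m}. infdist z (C i) \<le> \<eta>) \<longrightarrow> infdist z ?S \<le> e / 2"
      using reg[unfolded boundedly_regular_def, rule_format, OF _ M(1), of "e / 2"] by blast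
    have "\<forall>\<^sub>F k in sequentially. \<forall>i\<in>{1..m}. infdist (u k) (C i) < \<eta>"
      using infC \<eta>(1) by (intro eventually_ball_finite ballI order_tendstoD(2)[OF infC]) auto
    then show "\<forall>\<^sub>F k in sequentially. dist (infdist (u k) ?S) 0 < e"
    proof eventually_elim
      case (elim k)
      then have "infdist (u k) ?S \<le> e / 2"
        using M(2) by (intro \<eta>(2)[rule_format]) (auto intro: less_imp_le)
      then show ?case
        using e by (simp add: infdist_nonneg)
    qed
  qed
  \<comment> \<open>The quasi-Fejer lemma concerns \<open>y\<close>; passing from \<open>u k\<close>
    to \<open>y k\<close> changes the distance to \<open>?S\<close> by at most
    \<open>b k\<close>.\<close>
  have yS: "(\<lambda>k. infdist (y k) ?S) \<longlonglongrightarrow> 0"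
  proof (rule tendsto_sandwich[where f = "\<lambda>k. 0"])
    show "(\<lambda>k. infdist (u k) ?S + b k) \<longlonglongrightarrow> 0"
      using tendsto_add[OF uS bL] by simp
    have "infdist (y k) ?S \<le> infdist (u k) ?S + b k" for k
      using infdist_triangle[of "y k" ?S "u k"] b(2)[of k] by (simp add: dist_norm norm_minus_commute)
    then show "\<forall>\<^sub>F k in sequentially. infdist (y k) ?S \<le> infdist (u k) ?S + b k"
      by simp
  qed (auto simp: infdist_nonneg)
  show thesis
  proof (rule quasi_fejer_convergent[where S = ?S and y = y and b = b])
    show "closed ?S"
      using C by auto
    show "dist (y (Suc k)) z \<le> dist (y k) z + b k" if "z \<in> ?S" for z k
      using quasi[OF that] by (simp add: dist_norm)
  qed (use b(1) b0 ne yS that in auto)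
qed

section \<open>Normalized subgradient steps\<close>

text \<open>The subgradient inequality is tested at the point \<open>x + r s / \<parallel>s\<parallel>\<close> of the ball on which
  \<^term>\<open>\<phi>\<close> stays below \<^term>\<open>\<phi> z\<close>.\<close>

lemma descent_direction_step:
  fixes \<phi> :: "'a::real_inner \<Rightarrow> real"
  assumes v: "descent_direction \<phi> z v"
    and ball: "\<And>u. u \<in> cball x r \<Longrightarrow> \<phi> u \<le> \<phi> z"
    and x: "\<phi> x < \<phi> z"
    and "0 \<le> r" "0 \<le> \<beta>" "\<beta> \<le> r"
  shows "(norm (z + \<beta> *\<^sub>R v - x))\<^sup>2 \<le> (norm (z - x))\<^sup>2 - r * \<beta>"
proof -
  \<comment> \<open>The point \<open>x\<close> has a smaller value than \<open>z\<close>, so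
    \<open>z\<close> is no minimizer and the direction is a genuine normalized subgradient.\<close>
  have "0 \<notin> subdifferential \<phi> z"
    using x by (auto simp: subdifferential_def not_le)
  then obtain s where s: "s \<in> subdifferential \<phi> z" and vs: "v = - (s /\<^sub>R norm s)"
    and s0: "s \<noteq> 0"
    using v by (auto simp: descent_direction_def)
  let ?u = "x + (r / norm s) *\<^sub>R s"
  have "\<phi> z + s \<bullet> (?u - z) \<le> \<phi> ?u"
    using s by (simp add: subdifferential_def)
  moreover have "\<phi> ?u \<le> \<phi> z"
    using s0 \<open>0 \<le> r\<close> by (intro ball) (simp add: dist_norm)
  moreover have "s \<bullet> (?u - z) = s \<bullet> (x - z) + r * norm s"
    using s0 by (simp add: inner_diff_right inner_add_right field_simps
        flip: power2_norm_eq_inner) (simp add: power2_eq_square)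
  ultimately have "s \<bullet> (x - z) \<le> - r * norm s"
    by simp
  then have "v \<bullet> (z - x) \<le> - r"
    using s0 by (simp add: vs inner_diff_right field_simps)
  then have *: "\<beta> * (v \<bullet> (z - x)) \<le> \<beta> * (- r)"
    using \<open>0 \<le> \<beta>\<close> by (rule mult_left_mono)
  \<comment> \<open>In the expanded square the cross term contributes at most
    \<open>- 2 * r * \<beta>\<close>. The quadratic term takes back at most
    \<open>r * \<beta>\<close>, because \<open>\<beta> \<le> r\<close>.\<close>
  have "\<beta> * \<beta> \<le> \<beta> * r"
    using assms by (intro mult_left_mono)
  moreover have "v \<bullet> v = 1"
    using s0 by (simp add: vs field_simps flip: power2_norm_eq_inner)
  moreover have "(norm (z + \<beta> *\<^sub>R v - x))\<^sup>2
      = (norm (z - x))\<^sup>2 + 2 * (\<beta> * (v \<bullet> (z - x))) + \<beta> * \<beta> * (v \<bullet> v)"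
    by (simp add: power2_norm_eq_inner inner_diff inner_add inner_commute algebra_simps)
  ultimately show ?thesis
    using * by (simp add: algebra_simps)
qed

lemma norm_descent_direction_le: "descent_direction \<phi> z v \<Longrightarrow> norm v \<le> 1"
  by (auto simp: descent_direction_def divide_simps split: if_splits)

text \<open>Bounding by the full sum serves two purposes: at \<open>n = K\<close> it measures the
  perturbation, and for smaller \<open>n\<close> it keeps the inner iterates near the limit.\<close>

lemma norm_sum_steps_le:
  fixes z :: "nat \<Rightarrow> 'a::real_normed_vector"
  assumes "\<And>n. n < K \<Longrightarrow> z (Suc n) = z n + \<beta> n *\<^sub>R v n \<and> 0 \<le> \<beta> n \<and> norm (v n) \<le> 1"
    and "n \<le> K"
  shows "norm (z n - z 0) \<le> (\<Sum>j<K. \<beta> j)"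
proof -
  have "norm (z n - z 0) \<le> (\<Sum>j<n. \<beta> j)"
    using assms(2)
  proof (induction n)
    case (Suc n)
    then have n: "z (Suc n) = z n + \<beta> n *\<^sub>R v n" "0 \<le> \<beta> n" "norm (v n) \<le> 1"
      using assms(1)[of n] by auto
    have "norm (z (Suc n) - z 0) \<le> norm (z n - z 0) + norm (\<beta> n *\<^sub>R v n)"
      using norm_triangle_ineq[of "z n - z 0" "\<beta> n *\<^sub>R v n"] n(1) by (simp add: algebra_simps)
    also have "norm (\<beta> n *\<^sub>R v n) \<le> \<beta> n"
      using n by (simp add: mult_left_le)
    finally show ?case
      using Suc by simp
  qed simp
  also have "\<dots> \<le> (\<Sum>j<K. \<beta> j)"
    using assms by (intro sum_mono2) auto
  finally show ?thesis .
qed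

section \<open>Convergence of the superiorized iteration and the dichotomy for its limit\<close>

theorem theorem4p1:
  fixes C :: "nat \<Rightarrow> 'a::{real_inner, complete_space} set"
    and Cstar :: "'a set"
    and \<phi> :: "'a \<Rightarrow> real"
    and m qbar N :: nat
    and r0 Lbar \<delta>star :: real
    and \<Omega> :: "nat \<Rightarrow> nat list set"
    and w :: "nat \<Rightarrow> nat list \<Rightarrow> real"
    and K :: "nat \<Rightarrow> nat"
    and \<beta> :: "nat \<Rightarrow> nat \<Rightarrow> real"
    and y :: "nat \<Rightarrow> 'a"
  assumes "m \<ge> 1"
    and "\<And>i. i \<in> {1..m} \<Longrightarrow> C i \<noteq> {} \<and> closed (C i) \<and> convex (C i)"
    and "(\<Inter>i\<in>{1..m}. C i) \<noteq> {}"
    and "boundedly_regular m C"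
    and "convex_on UNIV \<phi>" and "continuous_on UNIV \<phi>"
    and "minimizers \<phi> (\<Inter>i\<in>{1..m}. C i) \<noteq> {}"
    and "Cstar \<noteq> {}" and "Cstar \<subseteq> minimizers \<phi> (\<Inter>i\<in>{1..m}. C i)"
    and "0 < r0" and "r0 \<le> 1" and "Lbar \<ge> 1"
    and "\<And>x u. x \<in> Cstar \<Longrightarrow> u \<in> cball x r0 \<Longrightarrow> \<bar>\<phi> x - \<phi> u\<bar> \<le> Lbar * norm (x - u)"
    and "0 < \<delta>star" and "\<delta>star < 1 / real m" and "qbar \<ge> m"
    and "\<And>k. (\<Omega> k, w k) \<in> amalgamators_star m \<delta>star qbar"
    and "N \<ge> 1"
    and "superiorized_DSAP C \<phi> N \<Omega> w K \<beta> y"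
  shows "\<exists>ystar \<in> (\<Inter>i\<in>{1..m}. C i). y \<longlonglongrightarrow> ystar \<and>
    (ystar \<in> minimizers \<phi> (\<Inter>i\<in>{1..m}. C i) \<longleftrightarrow>
     \<not> (ystar \<notin> minimizers \<phi> (\<Inter>i\<in>{1..m}. C i) \<and>
        (\<exists>k0 c0. 0 < c0 \<and> c0 < 1 \<and>
           (\<forall>x\<in>Cstar. \<forall>k\<ge>k0.
              (norm (y (Suc k) - x))\<^sup>2 \<le> (norm (y k - x))\<^sup>2 - c0 * (\<Sum>n<K k. \<beta> k n)) \<and>
           (\<forall>x\<in>Cstar. \<forall>k\<ge>k0. (norm (y (Suc k) - x))\<^sup>2 < (norm (y k - x))\<^sup>2))))"
proof -
  let ?S = "\<Inter>i\<in>{1..m}. C i"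
  define b where "b k = (\<Sum>n<K k. \<beta> k n)" for k
  have K: "\<And>k. 1 \<le> K k"
    and \<beta>: "\<And>k n. n < K k \<Longrightarrow> 0 < \<beta> k n"
    and b: "summable b"
    using assms(19) by (auto simp: superiorized_DSAP_def b_def[abs_def])
  obtain z v where zv: "\<forall>k. z k 0 = y k \<and>
      (\<forall>n<K k. descent_direction \<phi> (z k n) (v k n) \<and>
               z k (Suc n) = z k n + \<beta> k n *\<^sub>R v k n) \<and>
      y (Suc k) = string_avg C (\<Omega> k) (w k) (z k (K k))"
    using assms(19) unfolding superiorized_DSAP_def by blast
  then have z0: "\<And>k. z k 0 = y k"
    and v: "\<And>k n. n < K k \<Longrightarrow> descent_direction \<phi> (z k n) (v k n)"
    and z: "\<And>k n. n < K k \<Longrightarrow> z k (Suc n) = z k n + \<beta> k n *\<^sub>R v k n"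
    and y: "\<And>k. y (Suc k) = string_avg C (\<Omega> k) (w k) (z k (K k))"
    by blast+
  have C: "closed (C i) \<and> convex (C i)" if "i \<in> {1..m}" for i
    using assms(2)[OF that] by simp
  have near: "norm (z k n - y k) \<le> b k" if "n \<le> K k" for k n
    unfolding b_def z0[symmetric] using z \<beta> norm_descent_direction_le[OF v] that
    by (intro norm_sum_steps_le[where v = "v k"]) (auto intro: less_imp_le)
  obtain l where l: "l \<in> ?S" "y \<longlonglongrightarrow> l"
  \<comment> \<open>The last inner iterate plays the role of \<open>u k\<close>: the whole
    superiorization phase is one perturbation of size at most \<open>b k\<close>.\<close>
  proof (rule perturbed_string_avg_convergent[where C = C and m = m and \<delta> = \<delta>star and q = qbar
        and \<Omega> = \<Omega> and w = w and b = b and u = "\<lambda>k. z k (K k)" and y = y, OF assms(1) C assms(3,4,14) _ assms(17) b _ y])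
    show "0 < qbar"
      using assms(1,16) by simp
    show "norm (z k (K k) - y k) \<le> b k" for k
      by (rule near) simp
  qed (assumption, rule that)
  \<comment> \<open>For a minimizing limit the equivalence in the goal holds by propositional logic,
    so only this implication remains.\<close>
  have "\<exists>k0 c0. 0 < c0 \<and> c0 < 1 \<and>
      (\<forall>x\<in>Cstar. \<forall>k\<ge>k0. (norm (y (Suc k) - x))\<^sup>2 \<le> (norm (y k - x))\<^sup>2 - c0 * b k) \<and>
      (\<forall>x\<in>Cstar. \<forall>k\<ge>k0. (norm (y (Suc k) - x))\<^sup>2 < (norm (y k - x))\<^sup>2)"
    if nonmin: "l \<notin> minimizers \<phi> ?S"
  proof -
    obtain x0 where x0: "x0 \<in> Cstar"
      using assms(8) by blast
    have min: "\<phi> x \<le> \<phi> u" if "x \<in> Cstar" "u \<in> ?S" for x u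
      using assms(9) that by (auto simp: minimizers_def)
    have CS: "Cstar \<subseteq> ?S"
      using assms(9) by (auto simp: minimizers_def)
    \<comment> \<open>A common value on \<open>Cstar\<close> lets one threshold, one
      \<open>r\<close> and one \<open>k0\<close> serve all of its points.\<close>
    have eq: "\<phi> x = \<phi> x0" if "x \<in> Cstar" for x
      using min[OF x0] min[OF that] CS x0 that by (meson order_antisym subsetD)
    obtain u0 where "u0 \<in> ?S" "\<phi> u0 < \<phi> l"
      using nonmin l(1) by (auto simp: minimizers_def not_le)
    then have lt: "\<phi> x0 < \<phi> l"
      using min[OF x0] by fastforce
    define \<gamma> where "\<gamma> = (\<phi> l - \<phi> x0) / 2"
    have \<gamma>: "0 < \<gamma>" "\<phi> x0 + \<gamma> < \<phi> l"
      using lt by (auto simp: \<gamma>_def field_simps)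
    \<comment> \<open>The bound \<open>\<gamma> / Lbar\<close> keeps \<phi> below
      \<open>\<phi> x0 + \<gamma>\<close>, or equal to it, on the ball of radius \<open>r\<close>
      around each point of \<open>Cstar\<close>. The bound \<open>r0 / 2\<close> makes the Lipschitz
      estimate applicable and gives \<open>r < 1\<close>, so that \<open>r\<close> can serve as
      \<open>c0\<close>.\<close>
    define r where "r = min (r0 / 2) (\<gamma> / Lbar)"
    have "0 < r" "r \<le> r0 / 2"
      using assms(10,12) \<gamma>(1) unfolding r_def by (simp, intro min.cobounded1)
    then have r: "0 < r" "r \<le> r0" "r < 1"
      using assms(10,11) by auto
    have "r \<le> \<gamma> / Lbar"
      by (simp add: r_def)
    then have Lr: "Lbar * r \<le> \<gamma>"
      using assms(12) by (simp add: field_simps)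
    have "isCont \<phi> l"
      using assms(6) by (simp add: continuous_on_eq_continuous_at)
    then have "\<forall>\<^sub>F u in nhds l. \<phi> x0 + \<gamma> < \<phi> u"
      using \<gamma>(2) by (auto simp: isCont_def tendsto_at_iff_tendsto_nhds intro: order_tendstoD)
    then obtain e where e: "0 < e" "\<And>u. dist u l < e \<Longrightarrow> \<phi> x0 + \<gamma> < \<phi> u"
      by (auto simp: eventually_nhds_metric)
    \<comment> \<open>The two halves of \<open>e\<close> keep every inner iterate within
      \<open>e\<close> of \<open>l\<close>; \<open>b k < r\<close> keeps every single step size
      below \<open>r\<close>.\<close>
    have "\<forall>\<^sub>F k in sequentially. dist (y k) l < e / 2"
      using e(1) by (intro tendstoD[OF l(2)]) auto
    moreover have "\<forall>\<^sub>F k in sequentially. b k < min r (e / 2)"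
      using e(1) r(1) by (intro order_tendstoD[OF summable_LIMSEQ_zero[OF b]]) auto
    ultimately have "\<forall>\<^sub>F k in sequentially. dist (y k) l < e / 2 \<and> b k < min r (e / 2)"
      by (rule eventually_conj)
    then obtain k0 where k0: "\<And>k. k \<ge> k0 \<Longrightarrow> dist (y k) l < e / 2 \<and> b k < min r (e / 2)"
      by (auto simp: eventually_sequentially)
    have dec: "(norm (y (Suc k) - x))\<^sup>2 \<le> (norm (y k - x))\<^sup>2 - r * b k"
      if x: "x \<in> Cstar" and k: "k \<ge> k0" for x k
    proof -
      \<comment> \<open>The losses of the single subgradient steps accumulate along the inner loop;
        the averaging step afterwards does not increase the distance to \<open>x\<close>.\<close>
      have "(norm (z k n - x))\<^sup>2 \<le> (norm (y k - x))\<^sup>2 - r * (\<Sum>j<n. \<beta> k j)" if "n \<le> K k" for n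
        using that
      proof (induction n)
        case 0
        then show ?case
          by (simp add: z0)
      next
        case (Suc n)
        then have n: "n < K k"
          by simp
        have "dist (z k n) l < e"
          using k0[OF k] near[of n k] n dist_triangle[of "z k n" l "y k"] by (auto simp: dist_norm)
        then have big: "\<phi> x0 + \<gamma> < \<phi> (z k n)"
          by (rule e(2))
        have "\<beta> k n \<le> b k"
          unfolding b_def using n \<beta> by (intro member_le_sum) (auto intro: less_imp_le)
        then have "\<beta> k n \<le> r"
          using k0[OF k] by simp
        moreover have "\<phi> u \<le> \<phi> (z k n)" if u: "u \<in> cball x r" for u
        proof -
          have "\<bar>\<phi> x - \<phi> u\<bar> \<le> Lbar * norm (x - u)"
            using x u r(2) by (intro assms(13)) auto
          also have "\<dots> \<le> Lbar * r"
            using u assms(12) by (intro mult_left_mono) (auto simp: dist_norm)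
          finally show ?thesis
            using Lr eq[OF x] big by linarith
        qed
        ultimately have "(norm (z k n + \<beta> k n *\<^sub>R v k n - x))\<^sup>2 \<le> (norm (z k n - x))\<^sup>2 - r * \<beta> k n"
          using v[OF n] \<beta>[OF n] r(1) eq[OF x] big \<gamma>(1)
          by (intro descent_direction_step) auto
        with Suc n show ?case
          by (simp add: z algebra_simps)
      qed
      then have "(norm (z k (K k) - x))\<^sup>2 \<le> (norm (y k - x))\<^sup>2 - r * b k"
        by (simp add: b_def)
      moreover have "norm (y (Suc k) - x) \<le> norm (z k (K k) - x)"
        unfolding y using assms(1,14,17) C CS x by (intro string_avg_fejer[where m = m]) auto
      then have "(norm (y (Suc k) - x))\<^sup>2 \<le> (norm (z k (K k) - x))\<^sup>2"
        by (intro power_mono) auto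
      ultimately show ?thesis
        by linarith
    qed
    moreover have "(norm (y (Suc k) - x))\<^sup>2 < (norm (y k - x))\<^sup>2"
      if "x \<in> Cstar" "k \<ge> k0" for x k
    proof -
      \<comment> \<open>At least one inner step of positive size is taken, which makes the decrease
        strict.\<close>
      have "0 < b k"
        unfolding b_def using K[of k] \<beta> by (intro sum_pos) (auto simp: lessThan_empty_iff)
      then have "0 < r * b k"
        using r(1) by simp
      then show ?thesis
        using dec[OF that] by linarith
    qed
    ultimately show ?thesis
      using r by blast
  qed
  with l show ?thesis
    unfolding b_def by blast
qed

end
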